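(* Let $(c_n)_{n\ge 1}$ be the sequence (A345973 in OEIS, beginning $1,1,1,2,3,6,10,20,36,73,\dots$) defined by the formal power series identity $$\sum_{n\ge 1} c_n x^n = x+\frac{x^2}{\prod_{n\ge 1}(1-c_n x^n)}.$$ For $n\ge 0$ let $\mathcal{A}_n$ be the set of bicolored ordered trees of size $n$ (that is, with exactly $n$ black edges) in the class $\mathcal{A}$ defined in the context. Then for every integer $n\ge 2$, $$|\mathcal{A}_n| = c_n.$$
   Context: All trees are finite, unlabeled, rooted and ordered (the child edges of each vertex are linearly ordered from left to right), and each edge is colored either black or gray. The size of a tree is its number of black edges (gray edges do not count). A leaf is a vertex with no children; in particular, the root of the singleton tree (a root with no edges) is a leaf. For a nonleaf vertex $v$, the child edges of $v$ are the edges from $v$ to its children, and the subtrees of $v$ are the trees rooted at the children of $v$, each consisting of a child and all its descendants with the edges among them (the edge joining $v$ to the child is not part of the subtree and does not count in its size); they are ordered left to right according to the order of the child edges of $v$. The class $\mathcal{A}$ is the set of all such bicolored trees satisfying the following four conditions. For each nonleaf vertex $v$: (1) $v$ has at least two black child edges; (2) the gray child edges of $v$ (if any) are right justified, that is, they lie to the right of all black child edges of $v$; (3) the subtrees of $v$ (over all child edges, black and gray), taken left to right, have weakly decreasing sizes. For each leaf: (4) its parent edge (if it has one) is black. The singleton tree belongs to $\mathcal{A}$ and has size $0$. *)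

theory Defs
  imports "HOL-Analysis.Analysis" "HOL-Computational_Algebra.Formal_Power_Series"
begin

subsection \<open>The sequence A345973\<close>

text \<open>
  The index of the infinite product is shifted by one, since \<^const>\<open>prodinf\<close> starts at
  \<open>0\<close>. It is taken in the topology of coefficientwise stabilization of formal power series.
  The value \<open>c 0\<close> is not part of the sequence and is irrelevant.
\<close>
definition is_A345973 :: "(nat \<Rightarrow> real) \<Rightarrow> bool" where
  "is_A345973 c \<longleftrightarrow>
     Abs_fps (\<lambda>n. if n = 0 then 0 else c n) =
       fps_X + fps_X ^ 2 / (\<Prod>n. 1 - fps_const (c (Suc n)) * fps_X ^ Suc n)"


subsection \<open>Bicolored ordered trees\<close>

datatype color = Black | Gray

text \<open>A tree is the left-to-right list of the child edges of its root, each given by its color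
  and the subtree below it.\<close>
datatype bitree = Node (child_edges: "(color \<times> bitree) list")

text \<open>The number of black edges (\<^const>\<open>size\<close> is the unrelated datatype size).\<close>
fun tree_size :: "bitree \<Rightarrow> nat" where
  "tree_size (Node es) = (\<Sum>(col, s)\<leftarrow>es. (if col = Black then 1 else 0) + tree_size s)"

text \<open>Every vertex of a tree is represented by the tree rooted at it. Distinct vertices may
  be identified by this, but the conditions below depend only on that tree.\<close>
fun vertices :: "bitree \<Rightarrow> bitree set" where
  "vertices (Node es) = insert (Node es) (\<Union>(col, s)\<in>set es. vertices s)"

definition is_leaf :: "bitree \<Rightarrow> bool" where
  "is_leaf v \<longleftrightarrow> child_edges v = []"

definition class_A :: "bitree set" where
  "class_A = {t. \<forall>v\<in>vertices t.
     (\<not> is_leaf v \<longrightarrow>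
        length (filter (\<lambda>e. fst e = Black) (child_edges v)) \<ge> 2 \<and>
        sorted_wrt (\<lambda>e e'. \<not> (fst e = Gray \<and> fst e' = Black)) (child_edges v) \<and>
        sorted_wrt (\<lambda>e e'. tree_size (snd e) \<ge> tree_size (snd e')) (child_edges v)) \<and>
     (\<forall>(col, s)\<in>set (child_edges v). is_leaf s \<longrightarrow> col = Black)}"

definition class_A_of_size :: "nat \<Rightarrow> bitree set" where
  "class_A_of_size n = {t \<in> class_A. tree_size t = n}"


subsection \<open>Existence of the sequence\<close>

text \<open>The infinite product always converges, and the defining identity has a solution.\<close>

lemma prod_nth_stable:
  fixes c :: "nat \<Rightarrow> real"
  assumes "n \<le> N"
  shows "fps_nth (\<Prod>k\<le>N. 1 - fps_const (c (Suc k)) * fps_X ^ Suc k) n =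
         fps_nth (\<Prod>k\<le>n. 1 - fps_const (c (Suc k)) * fps_X ^ Suc k) n"
  using assms
proof (induction N rule: dec_induct)
  case (step N)
  let ?f = "\<lambda>k. 1 - fps_const (c (Suc k)) * fps_X ^ Suc k"
  have "prod ?f {..Suc N} =
          prod ?f {..N} - (fps_const (c (Suc (Suc N))) * prod ?f {..N}) * fps_X ^ Suc (Suc N)"
    by (simp add: algebra_simps del: power_Suc)
  also have "fps_nth \<dots> n = fps_nth (prod ?f {..N}) n"
    using step.hyps by (simp add: fps_X_power_mult_right_nth del: power_Suc)
  finally show ?case using step.IH by simp
qed simp

lemma has_prod_A345973:
  fixes c :: "nat \<Rightarrow> real"
  shows "(\<lambda>k. 1 - fps_const (c (Suc k)) * fps_X ^ Suc k) has_prod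
           Abs_fps (\<lambda>n. fps_nth (\<Prod>k\<le>n. 1 - fps_const (c (Suc k)) * fps_X ^ Suc k) n)"
    (is "?f has_prod ?P")
proof -
  have "(\<lambda>N. \<Prod>k\<le>N. ?f k) \<longlonglongrightarrow> ?P"
  proof (rule tendsto_fpsI)
    fix n
    show "eventually (\<lambda>N. fps_nth (\<Prod>k\<le>N. ?f k) n = fps_nth ?P n) sequentially"
      using eventually_ge_at_top[of n]
    proof eventually_elim
      case (elim N)
      then show ?case by (simp only: fps_nth_Abs_fps prod_nth_stable[OF elim])
    qed
  qed
  moreover have "?P \<noteq> 0"
  proof
    assume "?P = 0"
    then have "fps_nth ?P 0 = 0" by simp
    then show False by simp
  qed
  ultimately show ?thesis
    by (simp add: has_prod_def raw_has_prod_def del: power_Suc)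
qed

lemma prodinf_A345973:
  fixes c :: "nat \<Rightarrow> real"
  shows "(\<Prod>k. 1 - fps_const (c (Suc k)) * fps_X ^ Suc k) =
           Abs_fps (\<lambda>n. fps_nth (\<Prod>k\<le>n. 1 - fps_const (c (Suc k)) * fps_X ^ Suc k) n)"
proof -
  have "\<exists>!p. (\<lambda>k. 1 - fps_const (c (Suc k)) * fps_X ^ Suc k) has_prod p"
    using has_prod_A345973[of c] has_prod_unique2 by blast
  then show ?thesis
    unfolding prodinf_def using has_prod_A345973[of c] by (blast intro: the1_equality)
qed

lemma inverse_nth_cong:
  fixes f g :: "real fps"
  assumes "\<And>i. i \<le> n \<Longrightarrow> fps_nth f i = fps_nth g i"
  shows "fps_nth (inverse f) n = fps_nth (inverse g) n"
  using assms
proof (induction n rule: less_induct)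
  case (less n)
  show ?case
  proof (cases n)
    case 0
    then show ?thesis using less.prems by simp
  next
    case (Suc m)
    have "fps_nth (inverse f) i = fps_nth (inverse g) i" if "i < n" for i
      using that less by simp
    then show ?thesis
      using less.prems Suc
      by (simp add: fps_inverse_def)
  qed
qed

function A345973 :: "nat \<Rightarrow> real" where
  "A345973 n = (if n = 0 then 0 else if n = 1 then 1 else
     fps_nth (inverse (\<Prod>k<n-2. 1 - fps_const (A345973 (Suc k)) * fps_X ^ Suc k)) (n - 2))"
  by auto
termination by (relation "Wellfounded.measure id") auto

declare A345973.simps [simp del]

lemma is_A345973_exists: "\<exists>c. is_A345973 c"
proof -
  let ?f = "\<lambda>k. 1 - fps_const (A345973 (Suc k)) * fps_X ^ Suc k"
  let ?P = "prodinf ?f"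
  have P0: "fps_nth ?P 0 = 1"
    unfolding prodinf_A345973 by simp
  have *: "A345973 (m + 2) = fps_nth (inverse ?P) m" for m
  proof -
    have "fps_nth (inverse (\<Prod>k<m. ?f k)) m = fps_nth (inverse ?P) m"
    proof (rule inverse_nth_cong)
      fix i assume "i \<le> m"
      show "fps_nth (\<Prod>k<m. ?f k) i = fps_nth ?P i"
      proof -
        have "fps_nth (\<Prod>k\<le>m. ?f k) i = fps_nth (\<Prod>k<m. ?f k) i"
        proof -
          have "(\<Prod>k\<le>m. ?f k) = (\<Prod>k<m. ?f k)
                  - (fps_const (A345973 (Suc m)) * (\<Prod>k<m. ?f k)) * fps_X ^ Suc m"
            by (simp add: lessThan_Suc_atMost[symmetric] algebra_simps del: power_Suc)
          then show ?thesis
            using \<open>i \<le> m\<close> by (simp add: fps_X_power_mult_right_nth del: power_Suc)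
        qed
        then show ?thesis
          using prod_nth_stable[OF \<open>i \<le> m\<close>, of A345973] by (simp add: prodinf_A345973 del: power_Suc)
      qed
    qed
    then show ?thesis by (subst A345973.simps) simp
  qed
  have "Abs_fps (\<lambda>n. if n = 0 then 0 else A345973 n) = fps_X + fps_X ^ 2 / ?P"
  proof (rule fps_ext)
    fix n
    have "fps_X ^ 2 / ?P = fps_X ^ 2 * inverse ?P"
      using P0 by (intro fps_divide_unit) simp
    then have eq: "fps_nth (fps_X + fps_X ^ 2 / ?P) n =
        (if n = 1 then 1 else 0) + (if n < 2 then 0 else fps_nth (inverse ?P) (n - 2))"
      by (simp only: fps_add_nth fps_X_nth fps_X_power_mult_nth)
    show "fps_nth (Abs_fps (\<lambda>n. if n = 0 then 0 else A345973 n)) n =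
        fps_nth (fps_X + fps_X ^ 2 / ?P) n"
    proof (cases "n < 2")
      case True
      then have "n = 0 \<or> n = 1" by linarith
      then show ?thesis unfolding eq by (auto simp: A345973.simps[of "Suc 0"])
    next
      case False
      then have "n - 2 + 2 = n" by linarith
      then show ?thesis unfolding eq using False *[of "n - 2"] by simp
    qed
  qed
  then have "is_A345973 A345973"
    unfolding is_A345973_def .
  then show ?thesis by blast
qed

end

theory Submission
  imports Defs
begin

text \<open>
  Read coefficientwise, the defining identity says \<open>c 1 = 1\<close>, and that for \<open>n \<ge> 2\<close> the number \<open>c n\<close>
  is the coefficient of \<open>x\<^sup>n\<^sup>-\<^sup>2\<close> in the product of the geometric series \<open>1 / (1 - c m x\<^sup>m)\<close>
  (\<open>A345973_recurrence\<close>). If there are \<open>c m\<close> kinds of objects of weight \<open>m\<close>, that product counts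
  the lists of objects with weakly decreasing weights by their total weight
  (\<open>decreasing_lists_gf\<close>). The objects are taken to be the trees of the class themselves, a tree
  weighing its size, but the singleton tree weighing \<open>1\<close>.

  It remains to match the trees of size \<open>n \<ge> 2\<close> with the lists of total weight \<open>n - 2\<close>
  (\<open>root_decomposition\<close>). The subtrees at the root form a list \<open>ts\<close> of nonsingleton trees
  followed by leaves. Let \<open>b \<ge> 2\<close> be the number of black child edges of the root. A gray edge
  never leads to a leaf, and by the decreasing sizes no gray edge can follow a leaf; so \<open>b\<close> and
  \<open>ts\<close> determine the tree (\<open>graft\<close>), and every \<open>b \<ge> 2\<close> occurs with every decreasing \<open>ts\<close>. The size
  is \<open>b\<close> plus the sizes of the trees in \<open>ts\<close>, which is \<open>2\<close> plus the total weight of the list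
  consisting of \<open>ts\<close> and \<open>b - 2\<close> singleton trees. The theorem follows by strong induction on \<open>n\<close>,
  because a list of total weight \<open>n - 2\<close> contains only objects of weight at most \<open>n - 2\<close>.
\<close>

section \<open>Lists with weakly decreasing weights\<close>

definition decreasing_lists :: "('a \<Rightarrow> nat) \<Rightarrow> 'a set \<Rightarrow> nat \<Rightarrow> 'a list set" where
  "decreasing_lists w S j =
     {us. set us \<subseteq> S \<and> sorted_wrt (\<lambda>u v. w u \<ge> w v) us \<and> sum_list (map w us) = j}"

lemma finite_decreasing_lists:
  assumes "finite S" and pos: "\<And>s. s \<in> S \<Longrightarrow> w s > 0"
  shows "finite (decreasing_lists w S j)"
proof (rule finite_subset)
  have "length us \<le> sum_list (map w us)" if "set us \<subseteq> S" for us
    using that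
  proof (induction us)
    case (Cons u us)
    then show ?case using pos[of u] by auto
  qed simp
  then show "decreasing_lists w S j \<subseteq> {us. set us \<subseteq> S \<and> length us \<le> j}"
    unfolding decreasing_lists_def by auto
  show "finite {us. set us \<subseteq> S \<and> length us \<le> j}"
    using assms(1) by (rule finite_lists_length_le)
qed

lemma decreasing_lists_le_Suc:
  "decreasing_lists w {s \<in> S. w s \<le> Suc N} j =
     decreasing_lists w {s \<in> S. w s \<le> N} j \<union>
     (if j < Suc N then {} else
       (\<lambda>(u, us). u # us) `
         ({s \<in> S. w s = Suc N} \<times> decreasing_lists w {s \<in> S. w s \<le> Suc N} (j - Suc N)))"
    (is "?L = ?R1 \<union> ?R2")
proof
  show "?L \<subseteq> ?R1 \<union> ?R2"
  proof
    fix us assume us: "us \<in> ?L"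
    show "us \<in> ?R1 \<union> ?R2"
    proof (cases us)
      case Nil
      then show ?thesis using us by (auto simp: decreasing_lists_def)
    next
      case (Cons v vs)
      show ?thesis
      proof (cases "w v = Suc N")
        case True
        then have "vs \<in> decreasing_lists w {s \<in> S. w s \<le> Suc N} (j - Suc N)" "\<not> j < Suc N"
            "v \<in> {s \<in> S. w s = Suc N}"
          using us Cons by (auto simp: decreasing_lists_def)
        then have "us \<in> ?R2" unfolding Cons by (auto simp: image_iff)
        then show ?thesis by blast
      next
        case False
        then have "w v \<le> N" using us Cons by (auto simp: decreasing_lists_def)
        then have "us \<in> ?R1" using us Cons by (fastforce simp: decreasing_lists_def)
        then show ?thesis by blast
      qed
    qed
  qed
next
  show "?R1 \<union> ?R2 \<subseteq> ?L"
    by (auto simp: decreasing_lists_def)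
qed

text \<open>A list counted for the bound \<open>Suc N\<close> but not for \<open>N\<close> begins with an element of weight
  \<open>Suc N\<close>, and what follows that element is again such a list. So raising the bound divides the
  generating function by \<open>1 - a x\<^sup>m\<close>, where \<open>m = Suc N\<close> and \<open>a\<close> counts the elements of
  weight \<open>m\<close>.\<close>
lemma decreasing_lists_gf:
  fixes w :: "'a \<Rightarrow> nat"
  assumes pos: "\<And>s. s \<in> S \<Longrightarrow> w s > 0"
    and fin: "\<And>m. m \<le> N \<Longrightarrow> finite {s \<in> S. w s = m}"
  shows "Abs_fps (\<lambda>j. real (card (decreasing_lists w {s \<in> S. w s \<le> N} j))) *
     (\<Prod>k<N. 1 - fps_const (real (card {s \<in> S. w s = Suc k})) * fps_X ^ Suc k) = 1"
  using fin
proof (induction N)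
  case 0
  have no_elems: "{s \<in> S. w s \<le> 0} = {}"
    using pos by fastforce
  have "decreasing_lists w {s \<in> S. w s \<le> 0} j = (if j = 0 then {[]} else {})" for j
    unfolding decreasing_lists_def no_elems by auto
  then show ?case by (intro fps_ext) auto
next
  case (Suc N)
  let ?F = "\<lambda>N. Abs_fps (\<lambda>j. real (card (decreasing_lists w {s \<in> S. w s \<le> N} j)))"
  let ?a = "real (card {s \<in> S. w s = Suc N})"
  have "{s \<in> S. w s \<le> Suc N} = (\<Union>m\<le>Suc N. {s \<in> S. w s = m})" by auto
  then have "finite {s \<in> S. w s \<le> Suc N}" using Suc.prems by simp
  then have finD: "finite (decreasing_lists w {s \<in> S. w s \<le> Suc N} j)" for j
    using pos by (intro finite_decreasing_lists) auto
  have "?F (Suc N) * (1 - fps_const ?a * fps_X ^ Suc N) = ?F N"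
  proof (rule fps_ext)
    fix j
    let ?D = "\<lambda>N j. decreasing_lists w {s \<in> S. w s \<le> N} j"
    let ?C = "if j < Suc N then {} else
       (\<lambda>(u, us). u # us) ` ({s \<in> S. w s = Suc N} \<times> ?D (Suc N) (j - Suc N))"
    have D: "?D (Suc N) j = ?D N j \<union> ?C"
      by (rule decreasing_lists_le_Suc)
    have "us \<notin> ?C" if "us \<in> ?D N j" for us
    proof
      assume "us \<in> ?C"
      then have "us \<noteq> []" "w (hd us) = Suc N" by (auto split: if_splits)
      moreover have "\<forall>u\<in>set us. w u \<le> N" using that by (auto simp: decreasing_lists_def)
      ultimately show False using hd_in_set[of us] by fastforce
    qed
    then have "?D N j \<inter> ?C = {}" by blast
    moreover have "finite (?D N j \<union> ?C)"
      unfolding D[symmetric] by (rule finD)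
    then have "finite (?D N j)" "finite ?C"
      unfolding finite_Un by blast+
    ultimately have "card (?D N j \<union> ?C) = card (?D N j) + card ?C"
      by (intro card_Un_disjoint)
    then have "card (?D (Suc N) j) = card (?D N j) + card ?C"
      unfolding D[symmetric] .
    also have "card ?C = (if j < Suc N then 0 else
        card {s \<in> S. w s = Suc N} * card (?D (Suc N) (j - Suc N)))"
      by (auto simp: card_image inj_on_def card_cartesian_product)
    finally have card: "real (card (?D (Suc N) j)) = real (card (?D N j)) +
        (if j < Suc N then 0 else ?a * real (card (?D (Suc N) (j - Suc N))))"
      by simp
    have "?F (Suc N) * (1 - fps_const ?a * fps_X ^ Suc N) =
        ?F (Suc N) - (fps_const ?a * ?F (Suc N)) * fps_X ^ Suc N"
      by (simp add: algebra_simps del: power_Suc)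
    then show "fps_nth (?F (Suc N) * (1 - fps_const ?a * fps_X ^ Suc N)) j = fps_nth (?F N) j"
      using card by (simp add: fps_X_power_mult_right_nth del: power_Suc)
  qed
  then have "?F (Suc N) * (\<Prod>k<Suc N. 1 - fps_const (real (card {s \<in> S. w s = Suc k})) * fps_X ^ Suc k)
      = ?F N * (\<Prod>k<N. 1 - fps_const (real (card {s \<in> S. w s = Suc k})) * fps_X ^ Suc k)"
    by (simp add: mult_ac del: power_Suc)
  also have "\<dots> = 1" using Suc by simp
  finally show ?case .
qed

lemma sorted_wrt_replicate: "R x x \<Longrightarrow> sorted_wrt R (replicate k x)"
  by (induction k) auto

lemma sorted_wrt_filter_append:
  assumes "sorted_wrt R xs"
    and "\<And>x y. x \<in> set xs \<Longrightarrow> y \<in> set xs \<Longrightarrow> R x y \<Longrightarrow> P y \<Longrightarrow> P x"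
  shows "filter P xs @ filter (\<lambda>x. \<not> P x) xs = xs"
  using assms
proof (induction xs)
  case (Cons x xs)
  have IH: "filter P xs @ filter (\<lambda>x. \<not> P x) xs = xs"
    using Cons.prems by (intro Cons.IH) auto
  show ?case
  proof (cases "P x")
    case False
    then have "filter P xs = []" using Cons.prems by (auto simp: filter_empty_conv)
    then show ?thesis using IH False by simp
  qed (use IH in simp)
qed simp


section \<open>The class of trees\<close>

abbreviation leaf :: bitree where
  "leaf \<equiv> Node []"

lemma is_leaf_iff: "is_leaf t \<longleftrightarrow> t = leaf"
  by (cases t) (auto simp: is_leaf_def)

lemma Node_in_class_A_iff:
  "Node es \<in> class_A \<longleftrightarrow>
     (es \<noteq> [] \<longrightarrow>
        length (filter (\<lambda>e. fst e = Black) es) \<ge> 2 \<and>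
        sorted_wrt (\<lambda>e e'. \<not> (fst e = Gray \<and> fst e' = Black)) es \<and>
        sorted_wrt (\<lambda>e e'. tree_size (snd e) \<ge> tree_size (snd e')) es) \<and>
     (Gray, leaf) \<notin> set es \<and> snd ` set es \<subseteq> class_A"
proof -
  have "(\<forall>(col, s)\<in>set es. is_leaf s \<longrightarrow> col = Black) \<longleftrightarrow> (Gray, leaf) \<notin> set es"
    using color.exhaust by (auto simp: is_leaf_iff)
  then show ?thesis
    unfolding class_A_def by (auto simp: is_leaf_def ball_Un split_beta)
qed

lemma leaf_in_class_A: "leaf \<in> class_A"
  by (simp add: Node_in_class_A_iff)

lemma length_Black_le_tree_size:
  "length (filter (\<lambda>e. fst e = Black) es) \<le> tree_size (Node es)"
  by (induction es) auto

lemma class_A_size_ge_2: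
  assumes "t \<in> class_A" "t \<noteq> leaf"
  shows "tree_size t \<ge> 2"
proof -
  obtain es where es: "t = Node es" by (cases t)
  then have "length (filter (\<lambda>e. fst e = Black) es) \<ge> 2"
    using assms unfolding es Node_in_class_A_iff by blast
  then show ?thesis
    unfolding es using length_Black_le_tree_size[of es] by linarith
qed

text \<open>Trees of size \<open>m\<close> get weight \<open>m\<close>, except that the singleton tree gets weight \<open>1\<close>. As no tree
  in the class has size \<open>1\<close>, this makes the number of trees of weight \<open>m\<close> equal to \<open>c m\<close> also for
  \<open>m = 1\<close>.\<close>
definition weight :: "bitree \<Rightarrow> nat" where
  "weight t = (if t = leaf then 1 else tree_size t)"

lemma weight_pos: "t \<in> class_A \<Longrightarrow> weight t > 0"
  using class_A_size_ge_2[of t] by (auto simp: weight_def)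

lemma weight_mono_iff:
  assumes "s \<in> class_A" "t \<in> class_A"
  shows "weight s \<le> weight t \<longleftrightarrow> tree_size s \<le> tree_size t"
  using class_A_size_ge_2[OF assms(1)] class_A_size_ge_2[OF assms(2)]
  by (auto simp: weight_def)

lemma weight_1: "{t \<in> class_A. weight t = 1} = {leaf}"
proof -
  have "t = leaf" if "t \<in> class_A" "weight t = 1" for t
    using class_A_size_ge_2[OF that(1)] that(2) by (auto simp: weight_def split: if_splits)
  then show ?thesis using leaf_in_class_A by (auto simp: weight_def)
qed

lemma weight_ge_2: "m \<ge> 2 \<Longrightarrow> {t \<in> class_A. weight t = m} = class_A_of_size m"
  by (auto simp: weight_def class_A_of_size_def)

lemma leaves_last:
  assumes "sorted_wrt (\<lambda>s t. tree_size s \<ge> tree_size t) ts" "set ts \<subseteq> class_A"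
  shows "ts = filter (\<lambda>t. t \<noteq> leaf) ts @ replicate (count_list ts leaf) leaf"
proof -
  have "filter (\<lambda>t. t \<noteq> leaf) ts @ filter (\<lambda>t. \<not> t \<noteq> leaf) ts = ts"
    using assms(1)
  proof (rule sorted_wrt_filter_append)
    fix s t assume "t \<in> set ts" "tree_size t \<le> tree_size s" "t \<noteq> leaf"
    then show "s \<noteq> leaf" using assms(2) class_A_size_ge_2[of t] by auto
  qed
  moreover have "filter (\<lambda>t. \<not> t \<noteq> leaf) ts = replicate (count_list ts leaf) leaf"
    by (induction ts) auto
  ultimately show ?thesis by simp
qed


section \<open>Decomposing a tree at its root\<close>

text \<open>For \<open>b \<ge> 2\<close> and decreasing \<open>ts\<close>, the only tree in the class with \<open>b\<close> black child edges at the root and with \<open>ts\<close> as its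
  sequence of nonsingleton subtrees: if \<open>b\<close> exceeds the length of \<open>ts\<close> then all child edges are
  black and the rest of them lead to leaves; otherwise no child of the root is a leaf, and
  the trees after the first \<open>b\<close> hang on gray edges.\<close>
definition graft :: "nat \<Rightarrow> bitree list \<Rightarrow> bitree" where
  "graft b ts = Node (map (Pair Black) (take b ts @ replicate (b - length ts) leaf) @
                      map (Pair Gray) (drop b ts))"

lemma graft_inject:
  assumes "graft b ts = graft b' ts'" "leaf \<notin> set ts" "leaf \<notin> set ts'"
  shows "b = b'" "ts = ts'"
proof -
  have black: "length (filter (\<lambda>e. fst e = Black) (child_edges (graft b ts))) = b" for b ts
    by (simp add: graft_def filter_map o_def)
  have sub: "filter (\<lambda>t. t \<noteq> leaf) (map snd (child_edges (graft b ts))) = ts"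
    if "leaf \<notin> set ts" for b ts
  proof -
    have "filter (\<lambda>t. t \<noteq> leaf) ts = ts" using that by (auto simp: filter_id_conv)
    then have "filter (\<lambda>t. t \<noteq> leaf) (take b ts) @ filter (\<lambda>t. t \<noteq> leaf) (drop b ts) = ts"
      by (simp flip: filter_append)
    then show ?thesis by (simp add: graft_def o_def)
  qed
  show "b = b'" using black assms(1) by metis
  show "ts = ts'" using sub assms by metis
qed

lemma tree_size_graft: "tree_size (graft b ts) = b + sum_list (map tree_size ts)"
proof -
  have B: "(\<Sum>(col, s)\<leftarrow>map (Pair Black) xs. (if col = Black then 1 else 0) + tree_size s) =
      length xs + sum_list (map tree_size xs)" for xs
    by (induction xs) auto
  have G: "(\<Sum>(col, s)\<leftarrow>map (Pair Gray) xs. (if col = Black then 1 else 0) + tree_size s) =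
      sum_list (map tree_size xs)" for xs
    by (induction xs) auto
  have "sum_list (map tree_size (take b ts)) + sum_list (map tree_size (drop b ts)) =
      sum_list (map tree_size ts)"
    by (simp flip: sum_list_append map_append)
  then show ?thesis
    unfolding graft_def tree_size.simps map_append[of "case_prod _"] sum_list_append B G
    by (simp add: sum_list_replicate)
qed

lemma graft_in_class_A:
  assumes "b \<ge> 2" "set ts \<subseteq> class_A - {leaf}"
    and "sorted_wrt (\<lambda>s t. tree_size s \<ge> tree_size t) ts"
  shows "graft b ts \<in> class_A"
proof -
  have subs: "set (take b ts) \<subseteq> class_A" "set (drop b ts) \<subseteq> class_A - {leaf}"
    using assms(2) set_take_subset[of b ts] set_drop_subset[of b ts] by blast+
  have sorted: "sorted_wrt (\<lambda>s t. tree_size s \<ge> tree_size t)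
      ((take b ts @ replicate (b - length ts) leaf) @ drop b ts)"
  proof (cases "b \<le> length ts")
    case False
    then show ?thesis using assms(3) by (auto simp: sorted_wrt_append sorted_wrt_replicate)
  qed (use assms(3) in simp)
  have black: "length (filter (\<lambda>e. fst e = Black) (child_edges (graft b ts))) = b"
    by (simp add: graft_def filter_map o_def)
  have subtrees: "map snd (child_edges (graft b ts)) =
      (take b ts @ replicate (b - length ts) leaf) @ drop b ts"
    by (simp add: graft_def o_def)
  have "sorted_wrt (\<lambda>e e'. tree_size (snd e) \<ge> tree_size (snd e')) (child_edges (graft b ts))"
    using sorted unfolding subtrees[symmetric] sorted_wrt_map .
  moreover have "sorted_wrt (\<lambda>e e'. \<not> (fst e = Gray \<and> fst e' = Black)) (child_edges (graft b ts))"
    by (auto simp: graft_def sorted_wrt_append sorted_wrt_map sorted_wrt_replicate)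
  moreover have "(Gray, leaf) \<notin> set (child_edges (graft b ts))"
      "snd ` set (child_edges (graft b ts)) \<subseteq> class_A"
    using subs leaf_in_class_A by (auto simp: graft_def)
  ultimately have "Node (child_edges (graft b ts)) \<in> class_A"
    using black assms(1) unfolding Node_in_class_A_iff by auto
  then show ?thesis by simp
qed

lemma class_A_is_graft:
  assumes "t \<in> class_A" "t \<noteq> leaf"
  obtains b ts where "t = graft b ts" "b \<ge> 2" "set ts \<subseteq> class_A - {leaf}"
    "sorted_wrt (\<lambda>s t. tree_size s \<ge> tree_size t) ts"
proof -
  obtain es where t: "t = Node es" by (cases t)
  then have es: "length (filter (\<lambda>e. fst e = Black) es) \<ge> 2"
      "sorted_wrt (\<lambda>e e'. \<not> (fst e = Gray \<and> fst e' = Black)) es"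
      "sorted_wrt (\<lambda>e e'. tree_size (snd e) \<ge> tree_size (snd e')) es"
      "(Gray, leaf) \<notin> set es" "snd ` set es \<subseteq> class_A"
    using assms by (auto simp: Node_in_class_A_iff)
  define bs where "bs = map snd (filter (\<lambda>e. fst e = Black) es)"
  define gs where "gs = map snd (filter (\<lambda>e. fst e \<noteq> Black) es)"
  have Gray: "col \<noteq> Black \<longleftrightarrow> col = Gray" for col by (cases col) auto
  have bs: "filter (\<lambda>e. fst e = Black) es = map (Pair Black) bs"
    unfolding bs_def by (induction es) auto
  have gs: "filter (\<lambda>e. fst e \<noteq> Black) es = map (Pair Gray) gs"
    unfolding gs_def by (induction es) (auto simp: Gray)
  have "filter (\<lambda>e. fst e = Black) es @ filter (\<lambda>e. fst e \<noteq> Black) es = es"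
    using es(2) by (rule sorted_wrt_filter_append) (auto simp flip: Gray)
  then have split: "es = map (Pair Black) bs @ map (Pair Gray) gs"
    unfolding bs gs by simp
  have sorted: "sorted_wrt (\<lambda>s t. tree_size s \<ge> tree_size t) (bs @ gs)"
    using es(3) unfolding split by (simp add: sorted_wrt_append sorted_wrt_map)
  have in_A: "set bs \<subseteq> class_A" "set gs \<subseteq> class_A - {leaf}" and len: "length bs \<ge> 2"
    using es(1,4,5) unfolding split by (auto simp: filter_map o_def image_Un image_image)
  define ts where "ts = filter (\<lambda>t. t \<noteq> leaf) (bs @ gs)"
  have "graft (length bs) ts = t"
  proof (cases "leaf \<in> set bs")
    case False
    then have "ts = bs @ gs" unfolding ts_def using in_A(2) by (intro filter_True) auto
    then show ?thesis by (simp add: graft_def t split)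
  next
    case True
    \<comment> \<open>A leaf has size \<open>0\<close>, so by the decreasing sizes no nonsingleton tree can follow it.\<close>
    have "gs = []"
    proof (rule ccontr)
      assume "gs \<noteq> []"
      then obtain g where "g \<in> set gs" by (cases gs) auto
      then have "tree_size g \<le> tree_size leaf" "tree_size g \<ge> 2"
        using sorted True in_A(2) class_A_size_ge_2[of g] unfolding sorted_wrt_append by blast+
      then show False by simp
    qed
    then have "filter (\<lambda>t. t \<noteq> leaf) bs = ts"
      by (simp add: ts_def)
    moreover have "sorted_wrt (\<lambda>s t. tree_size s \<ge> tree_size t) bs"
      using sorted by (simp add: sorted_wrt_append)
    ultimately have "bs = ts @ replicate (count_list bs leaf) leaf"
      using leaves_last[of bs] in_A(1) by metis
    then have bs_eq: "bs = ts @ replicate (length bs - length ts) leaf"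
      by (metis add_diff_cancel_left' length_append length_replicate)
    then have "length ts \<le> length bs" by (metis length_append le_add1)
    then have "graft (length bs) ts =
        Node (map (Pair Black) (ts @ replicate (length bs - length ts) leaf))"
      by (simp add: graft_def)
    also have "\<dots> = t"
      unfolding t split \<open>gs = []\<close> using bs_eq by simp
    finally show ?thesis .
  qed
  moreover have "set ts \<subseteq> class_A - {leaf}" using in_A by (auto simp: ts_def)
  moreover have "sorted_wrt (\<lambda>s t. tree_size s \<ge> tree_size t) ts"
    using sorted unfolding ts_def by (rule sorted_wrt_filter)
  ultimately show thesis using that len by blast
qed

text \<open>The leaves in a list carry no information beyond their number, which encodes how many black
  child edges the root has in excess of the required two. A black edge adds \<open>1\<close> to the size, and
  so does a leaf to the total weight; hence the \<open>- 2\<close>.\<close>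
lemma root_decomposition:
  assumes "n \<ge> 2"
  shows "bij_betw (\<lambda>us. graft (2 + count_list us leaf) (filter (\<lambda>t. t \<noteq> leaf) us))
           (decreasing_lists weight class_A (n - 2)) (class_A_of_size n)"
    (is "bij_betw ?g ?D _")
proof (rule bij_betw_imageI)
  have sorted_iff: "sorted_wrt (\<lambda>u v. weight u \<ge> weight v) us \<longleftrightarrow>
      sorted_wrt (\<lambda>u v. tree_size u \<ge> tree_size v) us" if "set us \<subseteq> class_A" for us
    using that by (induction us) (auto simp: weight_mono_iff subset_eq)
  have total: "sum_list (map weight us) =
      count_list us leaf + sum_list (map tree_size (filter (\<lambda>t. t \<noteq> leaf) us))" for us
    by (induction us) (auto simp: weight_def)
  show "inj_on ?g ?D"
  proof (rule inj_onI)
    fix us vs assume us: "us \<in> ?D" and vs: "vs \<in> ?D" and eq: "?g us = ?g vs"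
    have "count_list us leaf = count_list vs leaf"
        "filter (\<lambda>t. t \<noteq> leaf) us = filter (\<lambda>t. t \<noteq> leaf) vs"
      using graft_inject[OF eq] by auto
    then show "us = vs"
      using leaves_last[of us] leaves_last[of vs] us vs sorted_iff
      unfolding decreasing_lists_def mem_Collect_eq by metis
  qed
  show "?g ` ?D = class_A_of_size n"
  proof
    show "?g ` ?D \<subseteq> class_A_of_size n"
    proof
      fix t assume "t \<in> ?g ` ?D"
      then obtain us where us: "us \<in> ?D" and t: "t = ?g us" by blast
      have "t \<in> class_A"
        unfolding t using us sorted_iff
        by (intro graft_in_class_A sorted_wrt_filter) (auto simp: decreasing_lists_def)
      moreover have "tree_size t = n"
        using us assms total[of us] by (simp add: t tree_size_graft decreasing_lists_def)
      ultimately show "t \<in> class_A_of_size n" by (simp add: class_A_of_size_def)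
    qed
    show "class_A_of_size n \<subseteq> ?g ` ?D"
    proof
      fix t assume "t \<in> class_A_of_size n"
      then have t: "t \<in> class_A" "tree_size t = n" by (auto simp: class_A_of_size_def)
      then have "t \<noteq> leaf" using assms by auto
      then obtain b ts where bts: "t = graft b ts" "b \<ge> 2" "set ts \<subseteq> class_A - {leaf}"
          "sorted_wrt (\<lambda>s t. tree_size s \<ge> tree_size t) ts"
        using t(1) class_A_is_graft by metis
      define us where "us = ts @ replicate (b - 2) leaf"
      have "leaf \<notin> set ts" using bts(3) by blast
      have count_leaf: "count_list (replicate k leaf) leaf = k" for k by (induction k) auto
      have us_leaf: "count_list us leaf = b - 2" "filter (\<lambda>t. t \<noteq> leaf) us = ts"
        using bts(3) \<open>leaf \<notin> set ts\<close> by (auto simp: us_def filter_id_conv count_list_0_iff count_leaf)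
      have us_class: "set us \<subseteq> class_A" using bts(3) leaf_in_class_A by (auto simp: us_def)
      have "sorted_wrt (\<lambda>u v. tree_size u \<ge> tree_size v) us"
        using bts(4) by (auto simp: us_def sorted_wrt_append sorted_wrt_replicate)
      moreover have "sum_list (map weight us) = n - 2"
        unfolding total us_leaf using t(2) bts(1,2) by (simp add: tree_size_graft)
      ultimately have "us \<in> ?D" using us_class sorted_iff by (simp add: decreasing_lists_def)
      moreover have "t = ?g us" unfolding us_leaf using bts(1,2) by (simp only: le_add_diff_inverse)
      ultimately show "t \<in> ?g ` ?D" by blast
    qed
  qed
qed


section \<open>The recurrence for the sequence\<close>

lemma A345973_1:
  assumes "is_A345973 c"
  shows "c 1 = 1"
proof -
  let ?P = "\<Prod>k. 1 - fps_const (c (Suc k)) * fps_X ^ Suc k"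
  have "fps_nth ?P 0 \<noteq> 0" unfolding prodinf_A345973 by simp
  then have "fps_X ^ 2 / ?P = inverse ?P * fps_X ^ 2"
    by (simp add: fps_divide_unit mult.commute)
  then have "fps_nth (Abs_fps (\<lambda>n. if n = 0 then 0 else c n)) 1 =
      fps_nth (fps_X + inverse ?P * fps_X ^ 2) 1"
    using assms unfolding is_A345973_def by simp
  then show ?thesis by (simp add: fps_X_power_mult_right_nth)
qed

text \<open>A factor \<open>1 - c m x\<^sup>m\<close> with \<open>m > n\<close> does not affect the coefficient of \<open>x\<^sup>n\<close>, so the
  infinite product can be cut off.\<close>
lemma A345973_recurrence:
  assumes "is_A345973 c"
  shows "c (n + 2) = fps_nth (inverse (\<Prod>k<n. 1 - fps_const (c (Suc k)) * fps_X ^ Suc k)) n"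
proof -
  let ?f = "\<lambda>k. 1 - fps_const (c (Suc k)) * fps_X ^ Suc k"
  let ?P = "prodinf ?f"
  have "fps_nth ?P 0 \<noteq> 0" unfolding prodinf_A345973 by simp
  then have "fps_X ^ 2 / ?P = inverse ?P * fps_X ^ 2"
    by (simp add: fps_divide_unit mult.commute)
  then have "fps_nth (Abs_fps (\<lambda>n. if n = 0 then 0 else c n)) (n + 2) =
      fps_nth (fps_X + inverse ?P * fps_X ^ 2) (n + 2)"
    using assms unfolding is_A345973_def by simp
  then have "c (n + 2) = fps_nth (inverse ?P) n"
    by (simp add: fps_X_power_mult_right_nth)
  also have "\<dots> = fps_nth (inverse (prod ?f {..<n})) n"
  proof (rule inverse_nth_cong)
    fix i assume "i \<le> n"
    have "prod ?f {..n} = prod ?f {..<n} -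
        (fps_const (c (Suc n)) * prod ?f {..<n}) * fps_X ^ Suc n"
      by (simp add: lessThan_Suc_atMost[symmetric] algebra_simps del: power_Suc)
    then have "fps_nth (prod ?f {..n}) i = fps_nth (prod ?f {..<n}) i"
      using \<open>i \<le> n\<close> by (simp add: fps_X_power_mult_right_nth del: power_Suc)
    then show "fps_nth ?P i = fps_nth (prod ?f {..<n}) i"
      using prod_nth_stable[OF \<open>i \<le> n\<close>, of c] by (simp add: prodinf_A345973 del: power_Suc)
  qed
  finally show ?thesis .
qed

text \<open>The induction runs over weights instead of sizes, so that the objects counted by \<open>c 1\<close> are
  covered by the induction hypothesis.\<close>
lemma card_weight_eq:
  assumes "is_A345973 c" "m \<ge> 1"
  shows "finite {t \<in> class_A. weight t = m} \<and> real (card {t \<in> class_A. weight t = m}) = c m"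
  using assms(2)
proof (induction m rule: less_induct)
  case (less m)
  show ?case
  proof (cases "m = 1")
    case True
    then show ?thesis using A345973_1[OF assms(1)] by (simp only: weight_1) simp
  next
    case False
    define n where "n = m - 2"
    have m: "m = n + 2" using False less.prems by (simp add: n_def)
    have IH: "finite {t \<in> class_A. weight t = k}" "real (card {t \<in> class_A. weight t = k}) = c k"
      if "k \<ge> 1" "k \<le> n" for k
      using less.IH[of k] that m by auto
    have fin: "finite {t \<in> class_A. weight t = k}" if "k \<le> n" for k
    proof (cases "k = 0")
      case True
      then have "{t \<in> class_A. weight t = k} = {}" using weight_pos by auto
      then show ?thesis by (simp only: finite.emptyI)
    qed (use IH that in auto)
    let ?S = "{t \<in> class_A. weight t \<le> n}"
    have "?S = (\<Union>k\<le>n. {t \<in> class_A. weight t = k})" by auto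
    then have finS: "finite ?S" using fin by simp
    have "decreasing_lists weight class_A n = decreasing_lists weight ?S n"
    proof -
      have "weight u \<le> sum_list (map weight us)" if "u \<in> set us" for u us
        using that by (induction us) auto
      then show ?thesis by (auto simp: decreasing_lists_def)
    qed
    then have bij: "bij_betw (\<lambda>us. graft (2 + count_list us leaf) (filter (\<lambda>t. t \<noteq> leaf) us))
        (decreasing_lists weight ?S n) {t \<in> class_A. weight t = m}"
      using root_decomposition[of m] weight_ge_2[of m] m by simp
    have "finite (decreasing_lists weight ?S n)"
      using finS weight_pos by (intro finite_decreasing_lists) auto
    then have "finite {t \<in> class_A. weight t = m}"
      using bij_betw_finite[OF bij] by simp
    moreover have "real (card {t \<in> class_A. weight t = m}) = c m"
    proof -
      let ?F = "Abs_fps (\<lambda>j. real (card (decreasing_lists weight ?S j)))"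
      let ?P = "\<Prod>k<n. 1 - fps_const (c (Suc k)) * fps_X ^ Suc k"
      have P: "(\<Prod>k<n. 1 - fps_const (real (card {t \<in> class_A. weight t = Suc k})) * fps_X ^ Suc k) = ?P"
        using IH by (intro prod.cong) auto
      have "?P * ?F = 1"
        using decreasing_lists_gf[of class_A weight n, OF weight_pos fin] unfolding P
        by (simp add: mult.commute)
      then have "?F = inverse ?P"
        by (rule fps_inverse_unique[symmetric])
      then have "c m = fps_nth ?F n"
        using A345973_recurrence[OF assms(1), of n] m by simp
      then show ?thesis using bij_betw_same_card[OF bij] by simp
    qed
    ultimately show ?thesis by blast
  qed
qed

theorem mainTheorem1:
  fixes c :: "nat \<Rightarrow> real" and n :: nat
  assumes "is_A345973 c"
    and "n \<ge> 2"
  shows "finite (class_A_of_size n) \<and> real (card (class_A_of_size n)) = c n"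
  using card_weight_eq[OF assms(1), of n] assms(2) by (simp add: weight_ge_2)

end
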